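(* Let $m\ge 3$ and $n\ge 1$ be integers, and let the sets $E(k),U(k),NU(k),A(k)$ ($k\ge1$) be defined as in the context. Then for every $k\ge 1$ and every vector $\mathbf a\in\mathcal N(k)$, the $m$-gonal form $(\mathcal{GP}_m,\mathbf a)$ is new tight $\mathcal T(n)$-universal if and only if $\mathbf a\in NU(k)$.
   Context: Let $P_m(x)=\frac{(m-2)x^2-(m-4)x}{2}$ and $\mathcal{GP}_m=\{P_m(u):u\in\mathbb Z\}$. For $k\ge1$ let $\mathcal N(k)=\{(a_1,\dots,a_k)\in\mathbb N^k: a_1\le\cdots\le a_k\}$ ($\mathbb N$ = positive integers), $\mathcal N=\bigcup_k\mathcal N(k)$, and identify $\mathcal N(1)$ with $\mathbb N$. For $\mathbf a\in\mathcal N(k)$, $\mathbf b\in\mathcal N(s)$ with $k\le s$, write $\mathbf a\preceq\mathbf b$ (resp. $\mathbf a\prec\mathbf b$) if the sequence of entries of $\mathbf a$ is a subsequence (resp. proper subsequence) of the sequence of entries of $\mathbf b$. For $\mathbf a\in\mathcal N(k)$ and $g\in\mathbb N$, $\mathbf a*g\in\mathcal N(k+1)$ is the vector whose entries are those of $\mathbf a$ together with $g$, sorted increasingly. For $\mathbf a=(a_1,\dots,a_k)$ let $R'_{\mathcal{GP}_m}(\mathbf a)=\{a_1s_1+\cdots+a_ks_k:s_i\in\mathcal{GP}_m\}\setminus\{0\}$. Let $\mathcal T(n)$ be the set of integers $\ge n$. The pair $(\mathcal{GP}_m,\mathbf a)$ (the $m$-gonal form $\sum a_iP_m(x_i)$)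 is called tight $\mathcal T(n)$-universal if $R'_{\mathcal{GP}_m}(\mathbf a)=\mathcal T(n)$, and new tight $\mathcal T(n)$-universal if moreover $R'_{\mathcal{GP}_m}(\mathbf b)\subsetneq\mathcal T(n)$ for every $\mathbf b\in\mathcal N$ with $\mathbf b\prec\mathbf a$. Define $\Psi(\mathbf a)=\mathcal T(n)\setminus R'_{\mathcal{GP}_m}(\mathbf a)$, $\psi(\mathbf a)=\min\Psi(\mathbf a)$ if $\Psi(\mathbf a)\ne\emptyset$ and $\psi(\mathbf a)=\infty$ otherwise; for $\psi(\mathbf a)<\infty$ let $\mathcal E(\mathbf a)=\{g\in\mathbb Z: n\le g\le\psi(\mathbf a)-n\}\cup\{\psi(\mathbf a)\}$. Recursively: $E(1)=\{(n)\}$; $U(k)=\{\mathbf a\in E(k):\psi(\mathbf a)=\infty\}$; $NU(k)$ is the set of $\mathbf a\in U(k)$ such that no $\mathbf b\in\mathcal N$ with $\mathbf b\prec\mathbf a$ lies in $\bigcup_{i=1}^{k-1}U(i)$; $A(k)=E(k)\setminus U(k)$; $E(k+1)=\bigcup_{\mathbf a\in A(k)}\{\mathbf a*g: g\in\mathcal E(\mathbf a)\}$. *)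

theory Defs
  imports Main "HOL-Library.Sublist" "HOL-Library.Extended"
begin

text \<open>The numerator is always even (see \<open>polygonal_double\<close>), so \<open>div\<close> is exact division here.\<close>

definition polygonal :: "int \<Rightarrow> int \<Rightarrow> int" where
  "polygonal m x = ((m - 2) * x^2 - (m - 4) * x) div 2"

lemma polygonal_double: "2 * polygonal m x = (m - 2) * x^2 - (m - 4) * x"
proof -
  have "(m - 2) * x^2 - (m - 4) * x = (m - 2) * (x * (x - 1)) + 2 * x"
    by (simp add: algebra_simps power2_eq_square)
  moreover have "even (x * (x - 1))"
    by simp
  ultimately have "even ((m - 2) * x^2 - (m - 4) * x)"
    by simp
  then show ?thesis
    by (simp add: polygonal_def)
qed

definition GP :: "int \<Rightarrow> int set" where
  "GP m = range (polygonal m)"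

text \<open>
  Vectors are lists of integers with positive entries. The relations \<open>\<preceq>\<close> and \<open>\<prec>\<close>
  are \<^const>\<open>subseq\<close> and \<^const>\<open>strict_subseq\<close>, and \<open>a * g\<close> is \<^term>\<open>insort g a\<close>.
  The empty list is not a vector.
\<close>

definition Vec :: "nat \<Rightarrow> int list set" where
  "Vec k = {a. length a = k \<and> sorted a \<and> (\<forall>x\<in>set a. 0 < x)}"

definition Vecs :: "int list set" where
  "Vecs = (\<Union>k\<in>{1..}. Vec k)"

definition R' :: "int set \<Rightarrow> int list \<Rightarrow> int set" where
  "R' S a = {\<Sum>i<length a. a ! i * s i | s. \<forall>i<length a. s i \<in> S} - {0}"

definition T :: "int \<Rightarrow> int set" where
  "T n = {n..}"

definition tight_universal :: "int \<Rightarrow> int \<Rightarrow> int list \<Rightarrow> bool" where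
  "tight_universal m n a \<longleftrightarrow> R' (GP m) a = T n"

definition new_tight_universal :: "int \<Rightarrow> int \<Rightarrow> int list \<Rightarrow> bool" where
  "new_tight_universal m n a \<longleftrightarrow>
     tight_universal m n a \<and> (\<forall>b\<in>Vecs. strict_subseq b a \<longrightarrow> R' (GP m) b \<subset> T n)"

definition Psi :: "int \<Rightarrow> int \<Rightarrow> int list \<Rightarrow> int set" where
  "Psi m n a = T n - R' (GP m) a"

text \<open>The minimum exists when \<open>Psi m n a\<close> is nonempty, as this set is bounded below by \<open>n\<close>.\<close>

definition psi :: "int \<Rightarrow> int \<Rightarrow> int list \<Rightarrow> int extended" where
  "psi m n a = (if Psi m n a \<noteq> {} then Fin (LEAST x. x \<in> Psi m n a) else Pinf)"

text \<open>Only meaningful when \<open>psi m n a\<close> is finite; otherwise this set is empty.\<close>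

definition Ecand :: "int \<Rightarrow> int \<Rightarrow> int list \<Rightarrow> int set" where
  "Ecand m n a = (case psi m n a of Fin p \<Rightarrow> {n..p - n} \<union> {p} | _ \<Rightarrow> {})"

text \<open>
  The recursion starts at level \<open>1\<close>; level \<open>0\<close> is set to be empty and is never used.
  In the third equation the condition on \<open>a\<close> says that it lies in \<open>A (Suc k)\<close>
  (see \<open>E_Suc\<close>).
\<close>

fun E :: "int \<Rightarrow> int \<Rightarrow> nat \<Rightarrow> int list set" where
  "E m n 0 = {}"
| "E m n (Suc 0) = {[n]}"
| "E m n (Suc (Suc k)) =
     (\<Union>a\<in>E m n (Suc k) - {a \<in> E m n (Suc k). psi m n a = Pinf}. {insort g a | g. g \<in> Ecand m n a})"

definition U :: "int \<Rightarrow> int \<Rightarrow> nat \<Rightarrow> int list set" where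
  "U m n k = {a \<in> E m n k. psi m n a = Pinf}"

definition NU :: "int \<Rightarrow> int \<Rightarrow> nat \<Rightarrow> int list set" where
  "NU m n k = {a \<in> U m n k. \<not> (\<exists>b\<in>Vecs. strict_subseq b a \<and> b \<in> (\<Union>i\<in>{1..k - 1}. U m n i))}"

definition A :: "int \<Rightarrow> int \<Rightarrow> nat \<Rightarrow> int list set" where
  "A m n k = E m n k - U m n k"

lemma E_Suc:
  assumes "1 \<le> k"
  shows "E m n (Suc k) = (\<Union>a\<in>A m n k. {insort g a | g. g \<in> Ecand m n a})"
  using assms by (cases k) (auto simp: A_def U_def)

end

theory Submission
  imports Defs
begin

text \<open>
  If \<open>a\<close> is tight universal, \<open>b \<preceq> a\<close>, and \<open>p = \<psi>(b)\<close> is finite, then a representation of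
  \<open>p\<close> by \<open>a\<close> must use an entry \<open>g\<close> of \<open>a\<close> outside \<open>b\<close>. The remainder \<open>p - g\<close> is a
  nonnegative combination of entries \<open>\<ge> n\<close>, so it is \<open>0\<close> or at least \<open>n\<close>; that is,
  \<open>g \<in> \<E>(b)\<close> and \<open>b * g \<preceq> a\<close>. Starting from \<open>(n) \<preceq> a\<close>, this escalation has to stop, as the
  length of \<open>a\<close> bounds it, so every tight universal \<open>a\<close> contains a member of some \<open>U(j)\<close>.
  Both directions follow, since members of \<open>U(j)\<close> are tight universal.
\<close>

section \<open>Sums with coefficients from a set \<open>S\<close>\<close>

definition sums_from :: "int set \<Rightarrow> int list \<Rightarrow> int set" where
  "sums_from S a = {\<Sum>i<length a. a ! i * s i | s. \<forall>i<length a. s i \<in> S}"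

text \<open>Keeping 0 as a value is what makes the recursion \<open>sums_from_Cons\<close> available
  for induction on the list.\<close>

lemma R'_eq_sums_from: "R' S a = sums_from S a - {0}"
  by (simp add: R'_def sums_from_def)

lemma sums_from_Nil [simp]: "sums_from S [] = {0}"
  by (simp add: sums_from_def)

lemma sums_from_Cons: "sums_from S (x # a) = {x * t + v | t v. t \<in> S \<and> v \<in> sums_from S a}"
proof (intro equalityI subsetI)
  fix p assume "p \<in> sums_from S (x # a)"
  then obtain s where "\<forall>i<Suc (length a). s i \<in> S"
    and "p = (\<Sum>i<Suc (length a). (x # a) ! i * s i)"
    by (auto simp: sums_from_def)
  then have "p = x * s 0 + (\<Sum>i<length a. a ! i * (s \<circ> Suc) i)" and "s 0 \<in> S"
    and "\<forall>i<length a. (s \<circ> Suc) i \<in> S"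
    by (auto simp: sum.lessThan_Suc_shift simp del: sum.lessThan_Suc)
  then show "p \<in> {x * t + v | t v. t \<in> S \<and> v \<in> sums_from S a}"
    unfolding sums_from_def by blast
next
  fix p assume "p \<in> {x * t + v | t v. t \<in> S \<and> v \<in> sums_from S a}"
  then obtain t s where t: "t \<in> S" and s: "\<forall>i<length a. s i \<in> S"
    and p: "p = x * t + (\<Sum>i<length a. a ! i * s i)"
    by (auto simp: sums_from_def)
  have "p = (\<Sum>i<length (x # a). (x # a) ! i * case_nat t s i)"
    using p by (simp add: sum.lessThan_Suc_shift del: sum.lessThan_Suc)
  moreover have "\<forall>i<length (x # a). case_nat t s i \<in> S"
    using t s by (auto split: nat.split)
  ultimately show "p \<in> sums_from S (x # a)"
    unfolding sums_from_def by blast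
qed

text \<open>Entries of \<open>a\<close> outside \<open>b\<close> receive the coefficient 0.\<close>

lemma sums_from_mono:
  assumes "0 \<in> S" and "subseq b a"
  shows "sums_from S b \<subseteq> sums_from S a"
  using assms(2)
proof induction
  case (list_emb_Nil a)
  show ?case
  proof (induction a)
    case (Cons x a)
    then show ?case
      using assms(1) by (force simp: sums_from_Cons)
  qed simp
next
  case (list_emb_Cons b a x)
  have "v \<in> sums_from S (x # a)" if "v \<in> sums_from S b" for v
  proof -
    have "x * 0 + v \<in> sums_from S (x # a)"
      using assms(1) that list_emb_Cons unfolding sums_from_Cons by blast
    then show ?thesis by simp
  qed
  then show ?case by blast
next
  case (list_emb_Cons2 x y b a)
  then show ?case by (fastforce simp: sums_from_Cons)
qed

lemma set_subset_sums_from: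
  assumes "0 \<in> S" and "1 \<in> S"
  shows "set a \<subseteq> sums_from S a"
proof
  fix x assume "x \<in> set a"
  then have "subseq [x] a"
    by (simp add: subseq_singleton_left)
  moreover have "x \<in> sums_from S [x]"
    using assms(2) by (auto simp: sums_from_Cons intro: exI[of _ 1])
  ultimately show "x \<in> sums_from S a"
    using sums_from_mono[OF assms(1)] by blast
qed

lemma mult_zero_or_ge:
  fixes n x t :: int
  assumes "0 < n" and "n \<le> x" and "0 \<le> t"
  shows "x * t = 0 \<or> n \<le> x * t"
proof (cases "t = 0")
  case False
  then have "x * 1 \<le> x * t"
    using assms by (intro mult_left_mono) auto
  then show ?thesis using assms by linarith
qed simp

text \<open>Every term is 0 or at least \<open>n\<close>, and as \<open>n\<close> is positive this
  property survives addition.\<close>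

lemma sums_from_zero_or_ge:
  assumes "S \<subseteq> {0..}" and "0 < n" and "\<forall>x\<in>set a. n \<le> x" and "p \<in> sums_from S a"
  shows "p = 0 \<or> n \<le> p"
  using assms(3,4)
proof (induction a arbitrary: p)
  case (Cons x a)
  then obtain t v where "p = x * t + v" and "t \<in> S" and "v \<in> sums_from S a"
    by (auto simp: sums_from_Cons)
  moreover have "v = 0 \<or> n \<le> v"
    using Cons calculation by simp
  moreover have "x * t = 0 \<or> n \<le> x * t"
    using Cons.prems assms calculation by (intro mult_zero_or_ge) auto
  ultimately show ?case using assms(2) by linarith
qed simp

lemma insort_Cons_le:
  assumes "sorted (y # xs)" and "y \<le> g"
  shows "insort g (y # xs) = y # insort g xs"
  using assms by (cases xs) auto

text \<open>The combinatorial core of the escalation. Induction along \<open>a\<close> looks for an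
  entry outside \<open>b\<close> with nonzero coefficient; \<open>p\<close> is left arbitrary
  because removing the head term changes the value.\<close>

lemma sums_from_subseq_or_insort:
  assumes S: "S \<subseteq> {0..}" and n: "0 < n"
    and "\<forall>x\<in>set a. n \<le> x" and "sorted a" and "subseq b a" and "p \<in> sums_from S a"
  shows "p \<in> sums_from S b \<or>
    (\<exists>g\<in>set a. subseq (insort g b) a \<and> (p = g \<or> n \<le> p - g))"
  using assms(3-)
proof (induction a arbitrary: b p)
  case (Nil b p)
  have "b = []" using Nil(3) by (rule list_emb_Nil2)
  then show ?case using Nil(4) by simp
next
  case (Cons y ys b p)
  obtain t v where p: "p = y * t + v" and t: "t \<in> S" and v: "v \<in> sums_from S ys"
    using Cons.prems by (auto simp: sums_from_Cons)
  have v_ge: "v = 0 \<or> n \<le> v"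
    using sums_from_zero_or_ge[OF S n _ v] Cons.prems by simp
  have t_ge: "0 \<le> t" using S t by auto
  have y: "n \<le> y" using Cons.prems by simp
  from \<open>subseq b (y # ys)\<close> consider
    (skip) "subseq b ys" | (take) xs where "b = y # xs" "subseq xs ys"
    by (cases rule: list_emb.cases) auto
  then show ?case
  proof cases
    case skip
    show ?thesis
    proof (cases "t = 0")
      case True
      then show ?thesis
        using Cons.IH[OF _ _ skip v] Cons.prems p by auto
    next
      case False
      have "set b \<subseteq> set ys"
        using skip set_nths_subset by (fastforce simp: subseq_conv_nths)
      then have "insort y b = y # b"
        using Cons.prems by (cases b) auto
      moreover have "p - y = y * (t - 1) + v"
        by (simp add: p algebra_simps)
      moreover have "y * (t - 1) = 0 \<or> n \<le> y * (t - 1)"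
        using n y t_ge False by (intro mult_zero_or_ge) auto
      ultimately have "subseq (insort y b) (y # ys)" and "p = y \<or> n \<le> p - y"
        using skip v_ge n by auto
      then show ?thesis by auto
    qed
  next
    case take
    consider (in_sub) "v \<in> sums_from S xs"
      | (new) g where "g \<in> set ys" "subseq (insort g xs) ys" "v = g \<or> n \<le> v - g"
      using Cons.IH[OF _ _ take(2) v] Cons.prems by auto
    then show ?thesis
    proof cases
      case in_sub
      then show ?thesis
        using t p take by (auto simp: sums_from_Cons)
    next
      case new
      \<comment> \<open>Sortedness lets \<open>g\<close>, found in the tail, be inserted behind the
        shared head \<open>y\<close>. Adding \<open>y * t\<close> to \<open>v\<close> keeps the
        difference to \<open>g\<close> at 0 or at least \<open>n\<close>.\<close>
      have "sorted (y # xs)"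
        using sorted_nths[OF Cons.prems(2)] Cons.prems(3) take(1)
        unfolding subseq_conv_nths by metis
      then have "insort g (y # xs) = y # insort g xs"
        using Cons.prems new by (intro insort_Cons_le) auto
      then have "subseq (insort g b) (y # ys)"
        using new take by simp
      moreover have "y * t = 0 \<or> n \<le> y * t"
        using n y t_ge by (intro mult_zero_or_ge) auto
      then have "p = g \<or> n \<le> p - g"
        using new p n by auto
      ultimately show ?thesis using new by auto
    qed
  qed
qed

section \<open>Generalized polygonal numbers as coefficients\<close>

lemma zero_in_GP: "0 \<in> GP m"
  unfolding GP_def by (rule range_eqI[of _ _ 0]) (simp add: polygonal_def)

lemma one_in_GP: "1 \<in> GP m"
  unfolding GP_def by (rule range_eqI[of _ _ 1]) (simp add: polygonal_def)

text \<open>Twice the value is a combination of the products \<open>x * (x - 1)\<close> and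
  \<open>x * (x + 1)\<close> of consecutive integers, with weights \<open>m - 3\<close> and
  1.\<close>

lemma GP_nonneg:
  assumes "3 \<le> m"
  shows "GP m \<subseteq> {0..}"
proof -
  have "0 \<le> polygonal m x" for x
  proof -
    have *: "0 \<le> x * (x - 1)" "0 \<le> x * (x + 1)"
      by (auto simp: zero_le_mult_iff)
    have "2 * polygonal m x = (m - 3) * (x * (x - 1)) + x * (x + 1)"
      unfolding polygonal_double by (simp add: algebra_simps power2_eq_square)
    moreover have "0 \<le> (m - 3) * (x * (x - 1))"
      using assms *(1) by (intro mult_nonneg_nonneg[of "m - 3"]) linarith+
    ultimately show ?thesis using * by linarith
  qed
  then show ?thesis by (auto simp: GP_def)
qed

lemma R'_subset_T:
  assumes "3 \<le> m" and "1 \<le> n" and "\<forall>x\<in>set a. n \<le> x"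
  shows "R' (GP m) a \<subseteq> T n"
  using sums_from_zero_or_ge[OF GP_nonneg[OF assms(1)], of n a] assms
  by (auto simp: R'_eq_sums_from T_def)

text \<open>Each entry is itself a represented value, with coefficient 1 there and 0 elsewhere, and
  positivity keeps it in \<open>R'\<close>.\<close>

lemma tight_universal_ge:
  assumes "tight_universal m n a" and "\<forall>x\<in>set a. 0 < x" and "x \<in> set a"
  shows "n \<le> x"
proof -
  have "x \<in> R' (GP m) a"
    using assms set_subset_sums_from[OF zero_in_GP one_in_GP, of a m]
    by (auto simp: R'_eq_sums_from)
  then show ?thesis using assms by (simp add: tight_universal_def T_def)
qed

section \<open>The least missing value and the recursive sets\<close>

lemma psi_FinD:
  assumes "psi m n a = Fin p"
  shows "n \<le> p" and "p \<notin> R' (GP m) a"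
proof -
  have "\<exists>x. x \<in> Psi m n a" and p: "p = (LEAST x. x \<in> Psi m n a)"
    using assms by (auto simp: psi_def split: if_splits)
  then obtain x where x: "x \<in> Psi m n a" by blast
  \<comment> \<open>\<open>LEAST\<close> on \<open>int\<close> needs the lower bound \<open>n\<close>; reduce to \<open>nat\<close> by shifting.\<close>
  define j where "j = (LEAST i. n + int i \<in> Psi m n a)"
  have "n + int (nat (x - n)) \<in> Psi m n a"
    using x by (auto simp: Psi_def T_def)
  then have j: "n + int j \<in> Psi m n a"
    unfolding j_def by (rule LeastI)
  have "p = n + int j"
    unfolding p
  proof (rule Least_equality)
    show "n + int j \<in> Psi m n a" by (fact j)
  next
    fix y assume y: "y \<in> Psi m n a"
    then have "n + int (nat (y - n)) \<in> Psi m n a"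
      by (auto simp: Psi_def T_def)
    then have "j \<le> nat (y - n)"
      unfolding j_def by (rule Least_le)
    then show "n + int j \<le> y"
      using y by (auto simp: Psi_def T_def)
  qed
  then show "n \<le> p" and "p \<notin> R' (GP m) a"
    using j by (auto simp: Psi_def)
qed

lemma psi_eq_Pinf_iff: "psi m n a = Pinf \<longleftrightarrow> T n \<subseteq> R' (GP m) a"
  by (auto simp: psi_def Psi_def)

lemma psi_cases:
  obtains "psi m n a = Pinf" | p where "psi m n a = Fin p"
  by (cases "Psi m n a = {}") (auto simp: psi_def)

lemma E_properties:
  assumes "a \<in> E m n k"
  shows "length a = k" and "sorted a" and "\<forall>x\<in>set a. n \<le> x"
proof -
  have "length a = k \<and> sorted a \<and> (\<forall>x\<in>set a. n \<le> x)"
    using assms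
  proof (induction m n k arbitrary: a rule: E.induct)
    case (3 m n k)
    then obtain b g where b: "b \<in> E m n (Suc k)" and a: "a = insort g b"
      and g: "g \<in> Ecand m n b"
      by auto
    \<comment> \<open>Both parts of \<open>Ecand\<close> lie above \<open>n\<close>; for the
      isolated point \<open>p\<close> this is \<open>psi_FinD\<close>.\<close>
    have "n \<le> g"
      using g psi_FinD(1) by (cases rule: psi_cases[of m n b]) (auto simp: Ecand_def)
    then show ?case
      using 3(1)[OF b] a by (auto simp: sorted_insort set_insort_key)
  qed auto
  then show "length a = k" and "sorted a" and "\<forall>x\<in>set a. n \<le> x"
    by auto
qed

lemma E_imp_Vecs:
  assumes "1 \<le> n" and "1 \<le> k" and "a \<in> E m n k"
  shows "a \<in> Vecs"
  using assms E_properties[OF assms(3)] by (fastforce simp: Vecs_def Vec_def)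

text \<open>An infinite \<open>psi\<close> only says that nothing in \<open>T n\<close> is missed;
  the reverse inclusion comes from all entries being at least \<open>n\<close>.\<close>

lemma U_iff_tight_universal:
  assumes "3 \<le> m" and "1 \<le> n"
  shows "a \<in> U m n k \<longleftrightarrow> a \<in> E m n k \<and> tight_universal m n a"
  using R'_subset_T[OF assms] E_properties(3)[of a m n k]
  by (auto simp: U_def psi_eq_Pinf_iff tight_universal_def)

section \<open>Escalation inside a tight universal vector\<close>

lemma tight_universal_singleton_subseq:
  assumes "3 \<le> m" and "1 \<le> n" and "a \<in> Vec k" and "tight_universal m n a"
  shows "subseq [n] a"
proof -
  have ge: "\<forall>x\<in>set a. n \<le> x"
    using assms tight_universal_ge by (auto simp: Vec_def)
  have "n \<in> sums_from (GP m) a"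
    using assms by (auto simp: tight_universal_def R'_eq_sums_from T_def)
  \<comment> \<open>Starting from the empty list, the alternative \<open>n \<le> n - g\<close> is
    impossible because \<open>g\<close> is positive.\<close>
  then obtain g where "g \<in> set a" and "n = g \<or> n \<le> n - g"
    using sums_from_subseq_or_insort[OF GP_nonneg[OF assms(1)] _ ge, of "[]" n] assms
    by (auto simp: Vec_def)
  then have "n \<in> set a"
    using ge assms by auto
  then show ?thesis by (simp add: subseq_singleton_left)
qed

text \<open>The alternatives \<open>p = g\<close> and \<open>n \<le> p - g\<close> of
  \<open>sums_from_subseq_or_insort\<close> are exactly the two parts of
  \<open>Ecand\<close>.\<close>

lemma escalation_step:
  assumes "3 \<le> m" and "1 \<le> n" and "a \<in> Vec k" and "tight_universal m n a"
    and "subseq b a" and "psi m n b = Fin p"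
  obtains g where "g \<in> Ecand m n b" and "subseq (insort g b) a"
proof -
  have ge: "\<forall>x\<in>set a. n \<le> x"
    using assms tight_universal_ge by (auto simp: Vec_def)
  have "n \<le> p" and "p \<notin> R' (GP m) b"
    using psi_FinD[OF assms(6)] .
  then have "p \<in> sums_from (GP m) a" and "p \<notin> sums_from (GP m) b"
    using assms by (auto simp: tight_universal_def R'_eq_sums_from T_def)
  then obtain g where "g \<in> set a" "subseq (insort g b) a" "p = g \<or> n \<le> p - g"
    using sums_from_subseq_or_insort[OF GP_nonneg[OF assms(1)] _ ge _ assms(5), of p] assms
    by (auto simp: Vec_def)
  moreover from this have "g \<in> Ecand m n b"
    using ge assms(6) by (auto simp: Ecand_def)
  ultimately show ?thesis using that by blast
qed

text \<open>After \<open>i\<close> steps the process has either met some \<open>U m n j\<close> or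
  still has a vector of length \<open>i + 1\<close> below \<open>a\<close>.\<close>

lemma escalation:
  assumes "3 \<le> m" and "1 \<le> n" and "a \<in> Vec k" and "tight_universal m n a"
  shows "(\<exists>j\<ge>1. \<exists>b\<in>U m n j. subseq b a) \<or> (\<exists>b\<in>E m n (Suc i). subseq b a)"
proof (induction i)
  case 0
  then show ?case
    using tight_universal_singleton_subseq[OF assms] by simp
next
  case (Suc i)
  then show ?case
  proof (elim disjE bexE)
    fix b assume b: "b \<in> E m n (Suc i)" "subseq b a"
    show ?thesis
    proof (cases rule: psi_cases[of m n b])
      case 1
      then have "b \<in> U m n (Suc i)" using b by (simp add: U_def)
      then show ?thesis using b by (intro disjI1 exI[of _ "Suc i"]) auto
    next
      case (2 p)
      then obtain g where g: "g \<in> Ecand m n b" "subseq (insort g b) a"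
        using escalation_step[OF assms b(2)] by blast
      then have "insort g b \<in> E m n (Suc (Suc i))"
        using b 2 by auto
      then show ?thesis using g by blast
    qed
  qed blast
qed

lemma tight_universal_contains_U:
  assumes "3 \<le> m" and "1 \<le> n" and "a \<in> Vec k" and "tight_universal m n a"
  obtains j b where "1 \<le> j" and "b \<in> U m n j" and "subseq b a"
proof -
  \<comment> \<open>At level \<open>k + 1\<close> the vectors are longer than \<open>a\<close>,
    which leaves only the first alternative of \<open>escalation\<close>.\<close>
  have "\<not> subseq b a" if "b \<in> E m n (Suc k)" for b
    using E_properties(1)[OF that] assms(3) list_emb_length[of "(=)" b a] by (auto simp: Vec_def)
  then show ?thesis
    using escalation[OF assms, of k] that by blast
qed

theorem theorem3p1:
  fixes m n :: int and k :: nat and a :: "int list"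
  assumes "m \<ge> 3" and "n \<ge> 1" and "k \<ge> 1" and "a \<in> Vec k"
  shows "new_tight_universal m n a \<longleftrightarrow> a \<in> NU m n k"
proof
  assume new: "new_tight_universal m n a"
  then have tight: "tight_universal m n a" by (simp add: new_tight_universal_def)
  have no_sub: "\<not> strict_subseq b a" if "b \<in> U m n j" and "1 \<le> j" for b j
  proof -
    have "b \<in> E m n j" and "tight_universal m n b"
      using that U_iff_tight_universal[OF assms(1,2)] by auto
    then have "b \<in> Vecs" and "\<not> R' (GP m) b \<subset> T n"
      using E_imp_Vecs[OF assms(2) that(2)] by (auto simp: tight_universal_def)
    then show ?thesis
      using new by (auto simp: new_tight_universal_def)
  qed
  obtain j b where j: "1 \<le> j" and b: "b \<in> U m n j" and "subseq b a"
    using tight_universal_contains_U[OF assms(1,2,4) tight] .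
  \<comment> \<open>A member of some \<open>U m n j\<close> below \<open>a\<close> cannot be
    strictly below it, and its length then forces \<open>j = k\<close>.\<close>
  then have "b = a"
    using no_sub[OF b j] subseq_order.le_less by blast
  moreover have "length b = j"
    using b E_properties(1) by (auto simp: U_def)
  ultimately have "a \<in> U m n k"
    using b assms(4) by (simp add: Vec_def)
  then show "a \<in> NU m n k"
    using no_sub by (auto simp: NU_def)
next
  assume NU: "a \<in> NU m n k"
  then have tight: "tight_universal m n a"
    using U_iff_tight_universal[OF assms(1,2)] by (auto simp: NU_def)
  have "R' (GP m) b \<subset> T n" if b: "b \<in> Vecs" "strict_subseq b a" for b
  proof -
    have "subseq b a"
      using b(2) by (simp add: strict_subseq_def)
    then have "R' (GP m) b \<subseteq> R' (GP m) a"
      using sums_from_mono[OF zero_in_GP] by (auto simp: R'_eq_sums_from)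
    then have "R' (GP m) b \<subseteq> T n"
      using tight by (simp add: tight_universal_def)
    moreover have "\<not> tight_universal m n b"
    proof
      assume "tight_universal m n b"
      moreover obtain l where l: "b \<in> Vec l"
        using b by (auto simp: Vecs_def)
      ultimately obtain j c where c: "1 \<le> j" "c \<in> U m n j" "subseq c b"
        \<comment> \<open>Tight universality of \<open>b\<close> is refuted by descending to a
          member \<open>c\<close> of some \<open>U m n j\<close> inside \<open>b\<close>, which
          \<open>NU\<close> forbids below \<open>a\<close>.\<close>
        using tight_universal_contains_U[OF assms(1,2)] by blast
      have "c \<in> E m n j" using c by (simp add: U_def)
      then have "c \<in> Vecs" and "length c = j"
        using E_imp_Vecs[OF assms(2) c(1)] E_properties(1) by auto
      moreover have ca: "strict_subseq c a"
        using c(3) b(2) by (rule subseq_order.le_less_trans)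
      \<comment> \<open>This places \<open>j\<close> in the range \<open>{1..k - 1}\<close> that
        \<open>NU\<close> quantifies over.\<close>
      moreover have "length c < length a"
        using ca subseq_same_length[of c a] list_emb_length[of "(=)" c a]
        by (auto simp: strict_subseq_def order.strict_iff_order)
      ultimately show False
        using NU c assms(4) by (fastforce simp: NU_def Vec_def)
    qed
    ultimately show ?thesis by (auto simp: tight_universal_def)
  qed
  then show "new_tight_universal m n a"
    using tight by (simp add: new_tight_universal_def)
qed

end
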